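(* For every digraph $D$, $\mathrm{dc}(D) \leq \mathrm{dib}(D)$.
   Context: Digraphs are finite and loopless; digons (pairs of opposite arcs $uv$, $vu$) are permitted. A coloring of $D$ using $k$ colors is a surjective map from $V(D)$ onto a set of $k$ colors (every color class is nonempty); no condition is imposed on adjacent vertices. A coloring is acyclic if each color class induces a subdigraph with no directed cycle (a digon is a directed cycle of length 2). The dichromatic number $\mathrm{dc}(D)$ is the minimum number of colors in an acyclic coloring of $D$. With respect to a coloring of $D$, a vertex $u$ is a $b^+$-vertex if for every color $c$ different from the color of $u$ there is an arc $uw$ of $D$ with $w$ of color $c$; a vertex $v$ is a $b^-$-vertex if for every color $c$ different from the color of $v$ there is an arc $wv$ of $D$ with $w$ of color $c$. A $b$-coloring of $D$ is a coloring in which each color class contains a $b^+$-vertex and a $b^-$-vertex (possibly the same vertex). The dib-chromatic number $\mathrm{dib}(D)$ is the maximum $k$ such that $D$ admits an acyclic $b$-coloring with $k$ colors (the existence of such a $k$ is part of the assertion). *)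

theory Defs
  imports "Graph_Theory.Arc_Walk" "Graph_Theory.Digraph_Component"
begin

text \<open>
  Adjacent vertices may share a colour. \<open>C\<close> is exactly the set of colours used; in particular the
  digraph without vertices is coloured with \<open>0\<close> colours.
\<close>

definition coloring :: "('a, 'b) pre_digraph \<Rightarrow> ('a \<Rightarrow> 'c) \<Rightarrow> 'c set \<Rightarrow> bool" where
  "coloring D f C \<longleftrightarrow> f ` verts D = C"

definition color_class :: "('a, 'b) pre_digraph \<Rightarrow> ('a \<Rightarrow> 'c) \<Rightarrow> 'c \<Rightarrow> 'a set" where
  "color_class D f c = {v \<in> verts D. f v = c}"

text \<open>A \<open>pre_digraph.cycle\<close> is any nonempty directed cycle, so a digon is a cycle of length \<open>2\<close>.\<close>

definition acyclic_coloring :: "('a, 'b) pre_digraph \<Rightarrow> ('a \<Rightarrow> 'c) \<Rightarrow> 'c set \<Rightarrow> bool" where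
  "acyclic_coloring D f C \<longleftrightarrow>
     coloring D f C \<and> (\<forall>c\<in>C. \<nexists>p. pre_digraph.cycle (D \<restriction> color_class D f c) p)"

definition b_plus_vertex :: "('a, 'b) pre_digraph \<Rightarrow> ('a \<Rightarrow> 'c) \<Rightarrow> 'c set \<Rightarrow> 'a \<Rightarrow> bool" where
  "b_plus_vertex D f C u \<longleftrightarrow>
     u \<in> verts D \<and> (\<forall>c\<in>C. c \<noteq> f u \<longrightarrow> (\<exists>w \<in> color_class D f c. u \<rightarrow>\<^bsub>D\<^esub> w))"

definition b_minus_vertex :: "('a, 'b) pre_digraph \<Rightarrow> ('a \<Rightarrow> 'c) \<Rightarrow> 'c set \<Rightarrow> 'a \<Rightarrow> bool" where
  "b_minus_vertex D f C v \<longleftrightarrow>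
     v \<in> verts D \<and> (\<forall>c\<in>C. c \<noteq> f v \<longrightarrow> (\<exists>w \<in> color_class D f c. w \<rightarrow>\<^bsub>D\<^esub> v))"

definition b_coloring :: "('a, 'b) pre_digraph \<Rightarrow> ('a \<Rightarrow> 'c) \<Rightarrow> 'c set \<Rightarrow> bool" where
  "b_coloring D f C \<longleftrightarrow> coloring D f C \<and>
     (\<forall>c\<in>C. (\<exists>u \<in> color_class D f c. b_plus_vertex D f C u) \<and>
            (\<exists>v \<in> color_class D f c. b_minus_vertex D f C v))"

text \<open>
  Natural numbers serve as colours: the vertex sets of interest are finite, so every colouring can be
  renamed to one with colours in \<open>nat\<close>.
\<close>

definition has_acyclic_coloring :: "('a, 'b) pre_digraph \<Rightarrow> nat \<Rightarrow> bool" where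
  "has_acyclic_coloring D k \<longleftrightarrow>
     (\<exists>(f :: 'a \<Rightarrow> nat) C. acyclic_coloring D f C \<and> card C = k)"

definition has_acyclic_b_coloring :: "('a, 'b) pre_digraph \<Rightarrow> nat \<Rightarrow> bool" where
  "has_acyclic_b_coloring D k \<longleftrightarrow>
     (\<exists>(f :: 'a \<Rightarrow> nat) C. acyclic_coloring D f C \<and> b_coloring D f C \<and> card C = k)"

definition dc :: "('a, 'b) pre_digraph \<Rightarrow> nat" where
  "dc D = (LEAST k. has_acyclic_coloring D k)"

definition dib :: "('a, 'b) pre_digraph \<Rightarrow> nat" where
  "dib D = (GREATEST k. has_acyclic_b_coloring D k)"

end

theory Submission
  imports Defs
begin

text \<open>
  Every acyclic colouring with the least possible number of colours is already a b-colouring; hence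
  \<open>dc D\<close> is one of the numbers over which \<open>dib D\<close> is the maximum, and the maximum exists because a
  colouring cannot use more colours than there are vertices.

  For the first claim, suppose that a colour class contains no \<open>b\<^sup>+\<close>-vertex. Then every vertex \<open>v\<close>
  of the class misses some other colour among its out-neighbours, and it can be moved to the class of
  such a colour. All vertices of the class move at once, so the colour disappears. A class that
  receives vertices has no arc from a newcomer to an old member, so a directed cycle in it could not
  return after leaving the newcomers: it would lie within the old members or within the newcomers, and
  the latter all come from one class. Both sets are acyclic, so the recolouring saves a colour,
  contradicting minimality (\<open>recolor_class_away\<close>). Without a \<open>b\<^sup>-\<close>-vertex the same argument works
  with all arcs reversed.
\<close>

lemma cycle_induce_subgraph_iff:
  assumes "wf_digraph D"
  shows "(\<exists>p. pre_digraph.cycle (D \<restriction> S) p) \<longleftrightarrow> \<not> acyclic (Restr (arcs_ends D) S)"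
proof -
  interpret H: wf_digraph "D \<restriction> S"
    using assms by (rule wf_digraph.wellformed_induce_subgraph)
  have arcs: "arcs_ends (D \<restriction> S) = Restr (arcs_ends D) S"
    by (auto simp: arcs_ends_conv)
  have "(\<exists>p. H.cycle p) \<longleftrightarrow> (\<exists>p. H.closed_w p)"
    using H.closed_w_imp_cycle by (auto simp: H.cycle_altdef)
  also have "\<dots> \<longleftrightarrow> (\<exists>u. u \<rightarrow>\<^sup>+\<^bsub>D \<restriction> S\<^esub> u)"
    unfolding H.closed_w_def H.reachable1_awalk by blast
  finally show ?thesis
    by (simp add: arcs acyclic_def)
qed

lemma acyclic_coloring_iff:
  assumes "wf_digraph D"
  shows "acyclic_coloring D f C \<longleftrightarrow>
    f ` verts D = C \<and> (\<forall>c\<in>C. acyclic (Restr (arcs_ends D) (color_class D f c)))"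
  using cycle_induce_subgraph_iff[OF assms]
  unfolding acyclic_coloring_def coloring_def by blast

text \<open>
  Without edges from \<open>A\<close> to \<open>B\<close>, a path that starts in \<open>A\<close> stays in \<open>A\<close>, and a path that ends in \<open>B\<close>
  has been in \<open>B\<close> all along. So each cycle lies within one of the two sets.
\<close>

lemma acyclic_Restr_Un:
  assumes "acyclic (Restr R A)" and "acyclic (Restr R B)"
    and no_edge: "\<And>a b. a \<in> A \<Longrightarrow> b \<in> B \<Longrightarrow> (a, b) \<notin> R"
  shows "acyclic (Restr R (A \<union> B))"
proof -
  let ?U = "Restr R (A \<union> B)"
  have from_A: "(x, y) \<in> (Restr R A)\<^sup>+ \<and> y \<in> A" if "(x, y) \<in> ?U\<^sup>+" "x \<in> A" for x y
    using that
  proof (induction rule: trancl_induct)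
    case (base y)
    then show ?case using no_edge by blast
  next
    case (step y z)
    then have "(y, z) \<in> Restr R A" using no_edge by blast
    with step show ?case by (auto intro: trancl_into_trancl)
  qed
  have into_B: "(x, y) \<in> (Restr R B)\<^sup>+ \<and> x \<in> B" if "(x, y) \<in> ?U\<^sup>+" "y \<in> B" for x y
    using that
  proof (induction rule: converse_trancl_induct)
    case (base x)
    then show ?case using no_edge by blast
  next
    case (step x z)
    then have "(x, z) \<in> Restr R B" using no_edge by blast
    with step show ?case by (auto intro: trancl_into_trancl2)
  qed
  show ?thesis
  proof (rule acyclicI, intro allI notI)
    fix x
    assume cyc: "(x, x) \<in> ?U\<^sup>+"
    then have "x \<in> A \<union> B"
      by (auto elim: converse_tranclE)
    with cyc from_A into_B assms(1,2) show False
      unfolding acyclic_def by blast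
  qed
qed

text \<open>
  A single direction of non-adjacency has to be chosen for the whole class: if some newcomers lacked
  arcs to the old members and others lacked arcs from them, new cycles could arise.
\<close>

lemma recolor_class_away:
  assumes "wf_digraph D" and col: "acyclic_coloring D f C" and c: "c \<in> C"
    and g: "\<And>v. v \<in> color_class D f c \<Longrightarrow> g v \<in> C - {c}"
    and sep:
      "(\<forall>v \<in> color_class D f c. \<forall>w \<in> color_class D f (g v). \<not> v \<rightarrow>\<^bsub>D\<^esub> w) \<or>
       (\<forall>v \<in> color_class D f c. \<forall>w \<in> color_class D f (g v). \<not> w \<rightarrow>\<^bsub>D\<^esub> v)"
  shows "acyclic_coloring D (\<lambda>v. if f v = c then g v else f v) (C - {c})"
    (is "acyclic_coloring D ?f' _")
proof -
  let ?R = "arcs_ends D"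
  have onto: "f ` verts D = C"
    and acyc: "\<And>d. d \<in> C \<Longrightarrow> acyclic (Restr ?R (color_class D f d))"
    using col by (auto simp: acyclic_coloring_iff[OF assms(1)])
  have "?f' ` verts D = C - {c}"
  proof
    show "?f' ` verts D \<subseteq> C - {c}"
      using g onto by (auto simp: color_class_def)
    show "C - {c} \<subseteq> ?f' ` verts D"
    proof
      fix d
      assume d: "d \<in> C - {c}"
      then obtain v where "v \<in> verts D" "f v = d"
        using onto by blast
      with d show "d \<in> ?f' ` verts D"
        by (intro image_eqI[of _ _ v]) auto
    qed
  qed
  moreover have "acyclic (Restr ?R (color_class D ?f' d))" if d: "d \<in> C - {c}" for d
  proof -
    define Old where "Old = color_class D f d"
    define New where "New = {v \<in> color_class D f c. g v = d}"
    have split: "color_class D ?f' d = New \<union> Old" "color_class D ?f' d = Old \<union> New"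
      using d by (auto simp: New_def Old_def color_class_def)
    have acyc_Old: "acyclic (Restr ?R Old)"
      using acyc d by (simp add: Old_def)
    have acyc_New: "acyclic (Restr ?R New)"
      by (rule acyclic_subset[OF acyc[OF c]]) (auto simp: New_def)
    from sep show ?thesis
    proof
      assume "\<forall>v \<in> color_class D f c. \<forall>w \<in> color_class D f (g v). \<not> v \<rightarrow>\<^bsub>D\<^esub> w"
      then show ?thesis
        unfolding split(1)
        by (intro acyclic_Restr_Un acyc_New acyc_Old) (auto simp: New_def Old_def)
    next
      assume "\<forall>v \<in> color_class D f c. \<forall>w \<in> color_class D f (g v). \<not> w \<rightarrow>\<^bsub>D\<^esub> v"
      then show ?thesis
        unfolding split(2)
        by (intro acyclic_Restr_Un acyc_New acyc_Old) (auto simp: New_def Old_def)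
    qed
  qed
  ultimately show ?thesis
    by (simp add: acyclic_coloring_iff[OF assms(1)])
qed

lemma minimum_acyclic_coloring_is_b_coloring:
  fixes f :: "'a \<Rightarrow> 'c"
  assumes "wf_digraph D" and "finite C" and col: "acyclic_coloring D f C"
    and minimum: "\<And>(f' :: 'a \<Rightarrow> 'c) C'. acyclic_coloring D f' C' \<Longrightarrow> card C \<le> card C'"
  shows "b_coloring D f C"
proof -
  have kept: "\<not> acyclic_coloring D f' (C - {c})" if "c \<in> C" for c and f' :: "'a \<Rightarrow> 'c"
    using minimum[of f' "C - {c}"] card_Diff1_less[OF \<open>finite C\<close> that] by linarith
  have plus: "\<exists>u \<in> color_class D f c. b_plus_vertex D f C u" if c: "c \<in> C" for c
  proof (rule ccontr)
    assume "\<not> ?thesis"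
    then have "\<forall>v \<in> color_class D f c. \<exists>d \<in> C - {c}. \<forall>w \<in> color_class D f d. \<not> v \<rightarrow>\<^bsub>D\<^esub> w"
      by (fastforce simp: b_plus_vertex_def color_class_def)
    then obtain g where
      "\<forall>v \<in> color_class D f c. g v \<in> C - {c} \<and> (\<forall>w \<in> color_class D f (g v). \<not> v \<rightarrow>\<^bsub>D\<^esub> w)"
      by metis
    then show False
      using recolor_class_away[OF assms(1) col c, of g] kept[OF c] by blast
  qed
  have minus: "\<exists>u \<in> color_class D f c. b_minus_vertex D f C u" if c: "c \<in> C" for c
  proof (rule ccontr)
    assume "\<not> ?thesis"
    then have "\<forall>v \<in> color_class D f c. \<exists>d \<in> C - {c}. \<forall>w \<in> color_class D f d. \<not> w \<rightarrow>\<^bsub>D\<^esub> v"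
      by (fastforce simp: b_minus_vertex_def color_class_def)
    then obtain g where
      "\<forall>v \<in> color_class D f c. g v \<in> C - {c} \<and> (\<forall>w \<in> color_class D f (g v). \<not> w \<rightarrow>\<^bsub>D\<^esub> v)"
      by metis
    then show False
      using recolor_class_away[OF assms(1) col c, of g] kept[OF c] by blast
  qed
  from col plus minus show ?thesis
    by (simp add: b_coloring_def acyclic_coloring_def)
qed

text \<open>The witness gives all vertices different colours; loop-freeness makes singletons acyclic.\<close>

lemma has_acyclic_coloring_ex:
  assumes "digraph D"
  shows "\<exists>k. has_acyclic_coloring D k"
proof -
  interpret digraph D by fact
  obtain f :: "'a \<Rightarrow> nat" where inj: "inj_on f (verts D)"
    using finite_imp_inj_to_nat_seg[OF finite_verts] by blast
  have "Restr (arcs_ends D) (color_class D f c) = {}" for c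
    using inj adj_not_same by (auto simp: color_class_def inj_on_def)
  then have "acyclic_coloring D f (f ` verts D)"
    by (simp add: acyclic_coloring_iff[OF wf_digraph] acyclic_def)
  then show ?thesis
    by (auto simp: has_acyclic_coloring_def)
qed

theorem theorem4:
  fixes D :: "('a, 'b) pre_digraph"
  assumes "digraph D"
  shows "(\<exists>k. has_acyclic_b_coloring D k \<and> (\<forall>j. has_acyclic_b_coloring D j \<longrightarrow> j \<le> k))
    \<and> dc D \<le> dib D"
proof -
  interpret digraph D by fact
  have "has_acyclic_coloring D (dc D)"
    unfolding dc_def using has_acyclic_coloring_ex[OF assms] by (rule LeastI_ex)
  then obtain f :: "'a \<Rightarrow> nat" and C where col: "acyclic_coloring D f C" and card: "card C = dc D"
    by (auto simp: has_acyclic_coloring_def)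
  have "finite C"
    using col by (auto simp: acyclic_coloring_def coloring_def)
  moreover have "card C \<le> card C'" if "acyclic_coloring D f' C'" for f' :: "'a \<Rightarrow> nat" and C'
    unfolding card dc_def using that by (intro Least_le) (auto simp: has_acyclic_coloring_def)
  ultimately have "b_coloring D f C"
    using minimum_acyclic_coloring_is_b_coloring[OF wf_digraph _ col] by blast
  then have dc: "has_acyclic_b_coloring D (dc D)"
    using col card by (auto simp: has_acyclic_b_coloring_def)
  have bound: "j \<le> card (verts D)" if "has_acyclic_b_coloring D j" for j
    using that by (auto simp: has_acyclic_b_coloring_def b_coloring_def coloring_def intro: card_image_le)
  have "has_acyclic_b_coloring D (dib D)"
    unfolding dib_def using dc bound by (rule GreatestI_nat)
  moreover have "j \<le> dib D" if "has_acyclic_b_coloring D j" for j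
    unfolding dib_def using that bound by (rule Greatest_le_nat)
  ultimately show ?thesis
    using dc by blast
qed

end
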